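(* Let $\{x^n\}_n$ be generated by Algorithm pBBDCA (described in the context) for minimizing $E=f+g_1-g_2$. Assume that $g_1$ is continuously differentiable with $\nabla g_1$ Lipschitz continuous with constant $L_{g_1}$, and that $E$ has the Kurdyka-Łojasiewicz (KL) property. Then: (i) (Monotonicity) There is an integer $N_0$ such that the sequence $\{E(x^n)\}_{n>N_0}$ is monotonically decreasing, and there exists a constant $\zeta$ such that $\lim_{n\to\infty}E(x^n)=\zeta$. (ii) (Boundedness) The iterates $\{x^n\}_n$ are bounded. (iii) (Optimality) Any cluster point of $\{x^n\}_n$ is a critical point of the problem $\min_{x\in X}E(x)$. (iv) (Convergence) The sequence $\{x^n\}_n$ is globally convergent, with $\sum_{n=1}^{\infty}\|x^n-x^{n-1}\|<\infty$.
   Context: Setting. $X$ is a finite-dimensional real Hilbert space with inner product $\langle\cdot,\cdot\rangle$ and norm $\|\cdot\|$. $E(x)=f(x)+g_1(x)-g_2(x)$, where $f$ is convex and continuously differentiable with $L$-Lipschitz gradient, and $g_1,g_2$ are proper closed convex functions. For a convex function, $\partial$ is the convex subdifferential. Standing assumptions: $E$ is bounded from below and all level sets $\{x:E(x)\le\alpha\}$, $\alpha\in\mathbb{R}$, are compact. When $g_1$ is differentiable, $\partial E(x):=\nabla f(x)+\nabla g_1(x)-\partial g_2(x)$; $x$ is a critical point if $0\in\partial E(x)$. $\mathrm{dist}(0,S)=\inf_{s\in S}\|s\|$. KL property. A closed proper function $h$ satisfies the KL property if for any critical point $\bar x$ of $h$ there exist $\nu\in(0,+\infty]$, a neighborhood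 $\mathcal{O}$ of $\bar x$ and a continuous concave function $\psi:[0,\nu)\to[0,+\infty)$ with $\psi(0)=0$ such that $\psi$ is continuously differentiable on $(0,\nu)$ with $\psi'>0$ there, and for every $x\in\mathcal{O}$ with $h(\bar x)<h(x)<h(\bar x)+\nu$ one has $\psi'(h(x)-h(\bar x))\cdot\mathrm{dist}(0,\partial h(x))\ge1$. Algorithm pBBDCA. Inputs: $x^0\in X$, $\alpha_0>0$, $0<\alpha_{\min}<\alpha_{\max}$, initial trial step $\lambda_0=1$, $\rho,\omega\in(0,1)$, $0<\eta<1/\alpha_{\max}$. For $n=0,1,2,\dots$: 1. Choose $\xi^n\in\partial g_2(x^n)$ and set $u^n=\arg\min_x\{\langle\nabla f(x^n)-\xi^n,x-x^n\rangle+\frac{1}{2\alpha_n}\|x-x^n\|^2+g_1(x)\}$. 2. Set $d^n=u^n-x^n$ and $\nu_n=\frac{\omega}{n+1}\|d^n\|^2$. If $d^n=0$, stop. 3. (Line search) Find the smallest integer $k\ge0$ such that the step $\lambda_n=\lambda_0\rho^k$ (here $\lambda_0=1$ is the initial trial step) satisfies $E(x^n+\lambda_nd^n)\le E(x^n)-\eta\lambda_n\|d^n\|^2+\nu_n$. 4. Set $x^{n+1}=x^n+\lambda_nd^n$, $s^n=x^{n+1}-x^n$, $y^n=\nabla f(x^{n+1})-\nabla f(x^n)$. 5. Set $\alpha_{n+1}=\max\{\alpha_{\min},\min\{\alpha_{\max},\langle s^n,s^n\rangle/\langle s^n,y^n\rangle\}\}$ if $\langle s^n,y^n\rangle>0$;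 otherwise $\alpha_{n+1}=\alpha_{\max}$. The sequences considered are infinite (no stopping rule other than $d^n=0$, and the algorithm does not stop). *)

theory Defs
  imports "HOL-Analysis.Analysis"
begin

text \<open>
  Extended-valued functions are \<open>ereal\<close>-valued. Closedness (lower semicontinuity) and convexity
  are expressed through the epigraph, taken in \<open>X \<times> \<real>\<close>; the library constant \<open>epigraph\<close> only
  covers real-valued functions.
\<close>

definition epi :: "('a \<Rightarrow> ereal) \<Rightarrow> ('a \<times> real) set" where
  "epi g = {(x, r). g x \<le> ereal r}"

definition proper_fun :: "('a \<Rightarrow> ereal) \<Rightarrow> bool" where
  "proper_fun g \<longleftrightarrow> (\<forall>x. g x \<noteq> -\<infinity>) \<and> (\<exists>x. g x \<noteq> \<infinity>)"

definition closed_fun :: "('a::topological_space \<Rightarrow> ereal) \<Rightarrow> bool" where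
  "closed_fun g \<longleftrightarrow> closed (epi g)"

definition convex_fun :: "('a::real_vector \<Rightarrow> ereal) \<Rightarrow> bool" where
  "convex_fun g \<longleftrightarrow> convex (epi g)"

text \<open>For proper \<open>g\<close> this set is empty at points outside the domain of \<open>g\<close>.\<close>

definition subdifferential :: "('a::real_inner \<Rightarrow> ereal) \<Rightarrow> 'a \<Rightarrow> 'a set" where
  "subdifferential g x = {v. \<forall>y. g x + ereal (v \<bullet> (y - x)) \<le> g y}"

text \<open>
  The objective \<open>E = f + g1 - g2\<close>. Where \<open>g1\<close> is finite, \<open>E\<close> takes the value \<open>-\<infinity>\<close> at the
  points with \<open>g2 = \<infinity>\<close>, so boundedness from below then forces \<open>g2\<close> to be finite.
\<close>

definition objective ::
    "('a \<Rightarrow> real) \<Rightarrow> ('a \<Rightarrow> ereal) \<Rightarrow> ('a \<Rightarrow> ereal) \<Rightarrow> 'a \<Rightarrow> ereal" where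
  "objective f g1 g2 x = ereal (f x) + g1 x - g2 x"

text \<open>
  The subdifferential of \<open>f + g1 - g2\<close> for differentiable \<open>f\<close> and \<open>g1\<close> with gradient maps
  \<open>Df\<close> and \<open>Dg1\<close>.
\<close>

definition objective_subdiff ::
    "('a::real_inner \<Rightarrow> 'a) \<Rightarrow> ('a \<Rightarrow> 'a) \<Rightarrow> ('a \<Rightarrow> ereal) \<Rightarrow> 'a \<Rightarrow> 'a set" where
  "objective_subdiff Df Dg1 g2 x = {Df x + Dg1 x - v | v. v \<in> subdifferential g2 x}"

definition critical_point :: "('a::zero \<Rightarrow> 'a set) \<Rightarrow> 'a \<Rightarrow> bool" where
  "critical_point Sh x \<longleftrightarrow> 0 \<in> Sh x"

text \<open>The distance is extended-valued, so that the distance to the empty set is \<open>\<infinity>\<close>.\<close>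

definition dist_zero :: "'a::real_normed_vector set \<Rightarrow> ereal" where
  "dist_zero S = (INF s\<in>S. ereal (norm s))"

definition desingularizing :: "ereal \<Rightarrow> (real \<Rightarrow> real) \<Rightarrow> (real \<Rightarrow> real) \<Rightarrow> bool" where
  "desingularizing \<nu> \<psi> \<psi>' \<longleftrightarrow>
     (let I = {t. 0 \<le> t \<and> ereal t < \<nu>}; J = {t. 0 < t \<and> ereal t < \<nu>} in
        continuous_on I \<psi> \<and> concave_on I \<psi> \<and> (\<forall>t\<in>I. 0 \<le> \<psi> t) \<and> \<psi> 0 = 0 \<and>
        (\<forall>t\<in>J. (\<psi> has_real_derivative \<psi>' t) (at t)) \<and>
        continuous_on J \<psi>' \<and> (\<forall>t\<in>J. 0 < \<psi>' t))"

text \<open>The KL property of \<open>h\<close>, relative to a given subdifferential map \<open>Sh\<close>.\<close>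

definition KL_property ::
    "('a::real_normed_vector \<Rightarrow> ereal) \<Rightarrow> ('a \<Rightarrow> 'a set) \<Rightarrow> bool" where
  "KL_property h Sh \<longleftrightarrow>
     proper_fun h \<and> closed_fun h \<and>
     (\<forall>xb. critical_point Sh xb \<longrightarrow>
        (\<exists>\<nu> U \<psi> \<psi>'. 0 < \<nu> \<and> open U \<and> xb \<in> U \<and> desingularizing \<nu> \<psi> \<psi>' \<and>
           (\<forall>x\<in>U. h xb < h x \<and> h x < h xb + \<nu> \<longrightarrow>
              1 \<le> ereal (\<psi>' (real_of_ereal (h x - h xb))) * dist_zero (Sh x))))"

text \<open>The function minimized by \<open>u\<^sup>n\<close>, with \<open>a = \<alpha>\<^sub>n\<close>, \<open>x = x\<^sup>n\<close> and \<open>w = Df(x\<^sup>n) - \<xi>\<^sup>n\<close>.\<close>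

definition prox_model ::
    "('a::real_inner \<Rightarrow> ereal) \<Rightarrow> real \<Rightarrow> 'a \<Rightarrow> 'a \<Rightarrow> 'a \<Rightarrow> ereal" where
  "prox_model g1 a w x z =
     ereal (w \<bullet> (z - x)) + ereal (1 / (2 * a) * (norm (z - x))\<^sup>2) + g1 z"

definition line_search_accepts ::
    "('a::real_normed_vector \<Rightarrow> ereal) \<Rightarrow> real \<Rightarrow> real \<Rightarrow> 'a \<Rightarrow> 'a \<Rightarrow> real \<Rightarrow> bool" where
  "line_search_accepts E \<eta> \<nu> x d l \<longleftrightarrow>
     E (x + l *\<^sub>R d) \<le> E x - ereal (\<eta> * l * (norm d)\<^sup>2) + ereal \<nu>"

definition BB_step :: "real \<Rightarrow> real \<Rightarrow> 'a::real_inner \<Rightarrow> 'a \<Rightarrow> real" where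
  "BB_step \<alpha>\<^sub>m\<^sub>i\<^sub>n \<alpha>\<^sub>m\<^sub>a\<^sub>x s y =
     (if s \<bullet> y > 0 then max \<alpha>\<^sub>m\<^sub>i\<^sub>n (min \<alpha>\<^sub>m\<^sub>a\<^sub>x ((s \<bullet> s) / (s \<bullet> y))) else \<alpha>\<^sub>m\<^sub>a\<^sub>x)"

text \<open>
  \<open>x\<close> is an infinite sequence generated by the method from \<open>x0\<close>: the stopping test \<open>d\<^sup>n = 0\<close> is
  never met. Every line search starts at the trial step 1, and \<open>k n\<close> is the number of
  backtracking reductions in iteration \<open>n\<close>.
\<close>

definition pBBDCA ::
    "('a::real_inner \<Rightarrow> real) \<Rightarrow> ('a \<Rightarrow> 'a) \<Rightarrow> ('a \<Rightarrow> ereal) \<Rightarrow> ('a \<Rightarrow> ereal) \<Rightarrow>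
     'a \<Rightarrow> real \<Rightarrow> real \<Rightarrow> real \<Rightarrow> real \<Rightarrow> real \<Rightarrow> real \<Rightarrow> (nat \<Rightarrow> 'a) \<Rightarrow> bool" where
  "pBBDCA f Df g1 g2 x0 \<alpha>\<^sub>0 \<alpha>\<^sub>m\<^sub>i\<^sub>n \<alpha>\<^sub>m\<^sub>a\<^sub>x \<rho> \<omega> \<eta> x \<longleftrightarrow>
     0 < \<alpha>\<^sub>0 \<and> 0 < \<alpha>\<^sub>m\<^sub>i\<^sub>n \<and> \<alpha>\<^sub>m\<^sub>i\<^sub>n < \<alpha>\<^sub>m\<^sub>a\<^sub>x \<and> 0 < \<rho> \<and> \<rho> < 1 \<and> 0 < \<omega> \<and> \<omega> < 1 \<and>
     0 < \<eta> \<and> \<eta> < 1 / \<alpha>\<^sub>m\<^sub>a\<^sub>x \<and> x 0 = x0 \<and>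
     (\<exists>\<xi> u d \<alpha> \<nu> k lam. \<alpha> 0 = \<alpha>\<^sub>0 \<and>
       (\<forall>n.
          \<xi> n \<in> subdifferential g2 (x n) \<and>
          is_arg_min (prox_model g1 (\<alpha> n) (Df (x n) - \<xi> n) (x n)) (\<lambda>_. True) (u n) \<and>
          d n = u n - x n \<and>
          \<nu> n = \<omega> / real (n + 1) * (norm (d n))\<^sup>2 \<and>
          d n \<noteq> 0 \<and>
          line_search_accepts (objective f g1 g2) \<eta> (\<nu> n) (x n) (d n) (\<rho> ^ k n) \<and>
          (\<forall>j<k n. \<not> line_search_accepts (objective f g1 g2) \<eta> (\<nu> n) (x n) (d n) (\<rho> ^ j)) \<and>
          lam n = \<rho> ^ k n \<and>
          x (Suc n) = x n + lam n *\<^sub>R d n \<and>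
          \<alpha> (Suc n) = BB_step \<alpha>\<^sub>m\<^sub>i\<^sub>n \<alpha>\<^sub>m\<^sub>a\<^sub>x (x (Suc n) - x n) (Df (x (Suc n)) - Df (x n))))"

definition cluster_point :: "(nat \<Rightarrow> 'a::topological_space) \<Rightarrow> 'a \<Rightarrow> bool" where
  "cluster_point x l \<longleftrightarrow> (\<exists>r. strict_mono r \<and> (x \<circ> r) \<longlonglongrightarrow> l)"

end

theory Submission
  imports Defs
begin

text \<open>
  Since \<open>g1\<close> is finite and \<open>E\<close> is bounded from below, \<open>g2\<close> is finite too, so everything happens
  among real functions and \<open>E\<close> is continuous. Three estimates along the iterates carry the proof.

  The first is sufficient decrease. The step \<open>d\<^sup>n\<close> is a descent direction whose slope is at most
  \<open>- \<parallel>d\<^sup>n\<parallel>\<^sup>2 / \<alpha>\<^sub>n\<close>, and the Lipschitz gradient of \<open>f\<close> costs only a term of second order in the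
  step length (\<open>dc_prox_descent\<close>). As \<open>\<eta> < 1 / \<alpha>\<^sub>m\<^sub>a\<^sub>x\<close>, from the second iteration on every step length below a
  fixed threshold is accepted, so backtracking never falls below a fixed \<open>\<tau> > 0\<close> (\<open>backtracking_lower_bound\<close>).
  The nonmonotone slack \<open>\<omega> / (n + 1) * \<parallel>d\<^sup>n\<parallel>\<^sup>2\<close> is therefore eventually at most half of the
  guaranteed decrease, and from then on \<open>E\<close> drops by at least \<open>c * \<parallel>d\<^sup>n\<parallel>\<^sup>2\<close> in each step. This
  gives monotonicity, convergence of the values, boundedness through the compact level sets, and
  \<open>d\<^sup>n \<longlonglongrightarrow> 0\<close>.

  The second is a small residual. Stationarity of \<open>u\<^sup>n\<close> expresses \<open>\<xi>\<^sup>n\<close> through gradients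
  (\<open>prox_model_stationary\<close>), so that \<open>Df x\<^sup>n + Dg1 x\<^sup>n - \<xi>\<^sup>n\<close>, an element of the subdifferential of
  \<open>E\<close> at \<open>x\<^sup>n\<close>, has norm at most \<open>C * \<parallel>d\<^sup>n\<parallel>\<close>. Cluster points are critical because the graph of the
  convex subdifferential is closed (\<open>subdifferential_closed_graph\<close>).

  The third is finite length. Near a cluster point the KL inequality turns these two estimates into
  \<open>\<parallel>d\<^sup>n\<parallel> \<le> C / c * (\<psi> (E x\<^sup>n - \<zeta>) - \<psi> (E x\<^sup>n\<^sup>+\<^sup>1 - \<zeta>))\<close>, which telescopes (\<open>KL_finite_length\<close>).
  The residual is measured at \<open>x\<^sup>n\<close>, where it is bounded by the same \<open>\<parallel>d\<^sup>n\<parallel>\<close> that governs the decrease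
  from \<open>x\<^sup>n\<close> to \<open>x\<^sup>n\<^sup>+\<^sup>1\<close>. Hence \<open>g2\<close> may be nonsmooth, and no comparison of consecutive step
  lengths enters.
\<close>

section \<open>Finite extended-valued convex functions\<close>

lemma epi_eq_epigraph:
  assumes "\<And>z. \<bar>g z\<bar> \<noteq> \<infinity>"
  shows "epi g = epigraph UNIV (\<lambda>z. real_of_ereal (g z))"
proof -
  have "g z \<le> ereal t \<longleftrightarrow> real_of_ereal (g z) \<le> t" for z t
    using assms[of z] by (cases "g z") auto
  then show ?thesis
    by (auto simp: epi_def epigraph_def)
qed

lemma convex_on_real_of_ereal:
  assumes "convex_fun g" and "\<And>z. \<bar>g z\<bar> \<noteq> \<infinity>"
  shows "convex_on UNIV (\<lambda>z. real_of_ereal (g z))"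
  using assms unfolding convex_fun_def by (simp add: epi_eq_epigraph convex_epigraph)

lemma subdifferential_real:
  assumes "\<And>z. \<bar>g z\<bar> \<noteq> \<infinity>"
  shows "v \<in> subdifferential g x \<longleftrightarrow>
    (\<forall>y. real_of_ereal (g x) + v \<bullet> (y - x) \<le> real_of_ereal (g y))"
proof -
  have "g x + ereal (v \<bullet> (y - x)) \<le> g y \<longleftrightarrow>
      real_of_ereal (g x) + v \<bullet> (y - x) \<le> real_of_ereal (g y)" for y
    using assms[of x] assms[of y] by (cases "g x"; cases "g y") auto
  then show ?thesis
    by (simp add: subdifferential_def)
qed

text \<open>
  A finite convex function on a Euclidean space is continuous, so the subgradient inequality
  survives the passage to the limit.
\<close>

lemma subdifferential_closed_graph:
  fixes g :: "'a::euclidean_space \<Rightarrow> ereal"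
  assumes "convex_fun g" and fin: "\<And>z. \<bar>g z\<bar> \<noteq> \<infinity>"
    and sub: "\<And>n. v n \<in> subdifferential g (x n)"
    and x: "x \<longlonglongrightarrow> l" and v: "v \<longlonglongrightarrow> w"
  shows "w \<in> subdifferential g l"
proof -
  let ?G = "\<lambda>z. real_of_ereal (g z)"
  have "continuous_on UNIV ?G"
    by (intro convex_on_continuous convex_on_real_of_ereal assms) simp
  then have G: "(\<lambda>n. ?G (x n)) \<longlonglongrightarrow> ?G l"
    using x by (rule continuous_on_tendsto_compose) auto
  have "?G l + w \<bullet> (y - l) \<le> ?G y" for y
  proof (rule LIMSEQ_le_const2)
    show "(\<lambda>n. ?G (x n) + v n \<bullet> (y - x n)) \<longlonglongrightarrow> ?G l + w \<bullet> (y - l)"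
      by (intro tendsto_intros G v x)
    show "\<exists>N. \<forall>n\<ge>N. ?G (x n) + v n \<bullet> (y - x n) \<le> ?G y"
      using sub by (auto simp: subdifferential_real[OF fin])
  qed
  then show ?thesis
    by (simp add: subdifferential_real[OF fin])
qed

section \<open>One proximal step\<close>

text \<open>The one-dimensional tangent inequality, applied on the line through \<open>a\<close> and \<open>b\<close>.\<close>

lemma convex_on_above_gradient:
  assumes "convex_on UNIV f" and "GDERIV f a :> v"
  shows "f a + v \<bullet> (b - a) \<le> f b"
proof -
  let ?p = "\<lambda>t::real. a + t *\<^sub>R (b - a)"
  have "convex_on UNIV (\<lambda>t. f (?p t))"
  proof (rule convex_onI)
    fix t y z :: real
    assume t: "0 < t" "t < 1"
    have "?p ((1 - t) *\<^sub>R y + t *\<^sub>R z) = (1 - t) *\<^sub>R ?p y + t *\<^sub>R ?p z"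
      by (simp add: algebra_simps)
    then show "f (?p ((1 - t) *\<^sub>R y + t *\<^sub>R z)) \<le> (1 - t) * f (?p y) + t * f (?p z)"
      using convex_onD[OF assms(1), of t "?p y" "?p z"] t by simp
  qed simp
  moreover have "((\<lambda>t. f (?p t)) has_field_derivative (v \<bullet> (b - a))) (at 0)"
  proof -
    have "(f has_derivative (\<lambda>h. h \<bullet> v)) (at (?p 0))"
      using assms(2) by (simp add: gderiv_def)
    moreover have "(?p has_derivative (\<lambda>t. t *\<^sub>R (b - a))) (at 0)"
      by (auto intro!: derivative_eq_intros)
    ultimately have "((\<lambda>t. f (?p t)) has_derivative (\<lambda>t. (t *\<^sub>R (b - a)) \<bullet> v)) (at 0)"
      using has_derivative_compose by blast
    then show ?thesis
      by (rule has_derivative_imp_has_field_derivative) (simp add: inner_commute)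
  qed
  ultimately have "(v \<bullet> (b - a)) * (1 - 0) \<le> f (?p 1) - f (?p 0)"
    by (intro convex_on_imp_above_tangent[where A = UNIV]) auto
  then show ?thesis
    by simp
qed

lemma prox_model_stationary:
  assumes fin: "\<And>z. \<bar>g z\<bar> \<noteq> \<infinity>"
    and grad: "GDERIV (\<lambda>z. real_of_ereal (g z)) u :> v"
    and min: "is_arg_min (prox_model g a w x) (\<lambda>_. True) u"
  shows "w + (1 / a) *\<^sub>R (u - x) + v = 0"
proof -
  let ?m = "\<lambda>z. w \<bullet> (z - x) + 1 / (2 * a) * ((z - x) \<bullet> (z - x)) + real_of_ereal (g z)"
  let ?D = "w + (1 / a) *\<^sub>R (u - x) + v"
  have m: "prox_model g a w x z = ereal (?m z)" for z
    using fin[of z] by (cases "g z") (auto simp: prox_model_def power2_norm_eq_inner)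
  have d: "((\<lambda>z. z - x) has_derivative (\<lambda>h. h)) (at u)"
    by (auto intro!: derivative_eq_intros)
  have quad: "((\<lambda>z. w \<bullet> (z - x) + 1 / (2 * a) * ((z - x) \<bullet> (z - x))) has_derivative
      (\<lambda>h. w \<bullet> h + 1 / (2 * a) * ((u - x) \<bullet> h + h \<bullet> (u - x)))) (at u)"
    by (intro has_derivative_eq_rhs[OF has_derivative_add[OF has_derivative_inner_right[OF d]
            has_derivative_mult_right[OF has_derivative_inner[OF d d]]]]) simp
  have "(?m has_derivative
      (\<lambda>h. w \<bullet> h + 1 / (2 * a) * ((u - x) \<bullet> h + h \<bullet> (u - x)) + h \<bullet> v)) (at u)"
    using has_derivative_add[OF quad grad[unfolded gderiv_def]] .
  moreover have "(\<lambda>h. w \<bullet> h + 1 / (2 * a) * ((u - x) \<bullet> h + h \<bullet> (u - x)) + h \<bullet> v)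
      = (\<lambda>h. h \<bullet> ?D)"
    by (simp add: fun_eq_iff inner_add_right inner_commute)
  ultimately have "(?m has_derivative (\<lambda>h. h \<bullet> ?D)) (at u)"
    by simp
  moreover have "?m u \<le> ?m z" for z
    using min unfolding is_arg_min_def m by (simp add: not_less)
  ultimately have "(\<lambda>h. h \<bullet> ?D) = (\<lambda>h. 0)"
    by (intro has_derivative_local_min always_eventually) auto
  then have "?D \<bullet> ?D = 0"
    by (rule fun_cong)
  then show ?thesis
    by simp
qed

text \<open>
  Each of the three parts of the objective is bounded by its slope along \<open>d = u - x\<close>: \<open>f\<close> up to the
  term \<open>L * l\<^sup>2 * \<parallel>d\<parallel>\<^sup>2\<close>, \<open>p\<close> because convexity between \<open>x\<close> and \<open>u\<close> and the tangent at \<open>u\<close> bound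
  its chord, and \<open>q\<close> by the subgradient \<open>\<xi>\<close>. Stationarity of \<open>u\<close> says that these slopes add up to
  \<open>- \<parallel>d\<parallel>\<^sup>2 / a\<close>.
\<close>

lemma dc_prox_descent:
  fixes f p q :: "'a::real_inner \<Rightarrow> real"
  assumes f: "convex_on UNIV f" "\<And>z. GDERIV f z :> Df z" "L-lipschitz_on UNIV Df"
    and p: "convex_on UNIV p" "GDERIV p u :> v"
    and q: "\<And>y. q x + \<xi> \<bullet> (y - x) \<le> q y"
    and stat: "(Df x - \<xi>) + (1 / a) *\<^sub>R (u - x) + v = 0"
    and l: "0 \<le> l" "l \<le> 1"
  shows "f (x + l *\<^sub>R (u - x)) + p (x + l *\<^sub>R (u - x)) - q (x + l *\<^sub>R (u - x))
    \<le> f x + p x - q x - l * (1 / a - L * l) * (norm (u - x))\<^sup>2"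
proof -
  define d where "d = u - x"
  let ?z = "x + l *\<^sub>R d"
  \<comment> \<open>The tangent of \<open>f\<close> at the new point, not at \<open>x\<close>: this bounds \<open>f\<close> from above, and the Lipschitz
    condition then exchanges the gradients. It gives the descent lemma with \<open>L\<close> in place of \<open>L / 2\<close>,
    which affects only constants.\<close>
  have "f ?z + Df ?z \<bullet> (x - ?z) \<le> f x"
    by (rule convex_on_above_gradient) (rule f)+
  moreover have "(Df ?z - Df x) \<bullet> (l *\<^sub>R d) \<le> L * (norm (l *\<^sub>R d))\<^sup>2"
  proof -
    have "(Df ?z - Df x) \<bullet> (l *\<^sub>R d) \<le> norm (Df ?z - Df x) * norm (l *\<^sub>R d)"
      by (rule norm_cauchy_schwarz)
    also have "\<dots> \<le> L * norm (l *\<^sub>R d) * norm (l *\<^sub>R d)"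
      using lipschitz_onD[OF f(3), of ?z x]
      by (intro mult_right_mono) (auto simp: dist_norm)
    finally show ?thesis
      by (simp add: power2_eq_square)
  qed
  ultimately have f': "f ?z \<le> f x + l * (Df x \<bullet> d) + L * l\<^sup>2 * (norm d)\<^sup>2"
    by (simp add: inner_diff_left power_mult_distrib algebra_simps)
  have "?z = (1 - l) *\<^sub>R x + l *\<^sub>R u"
    by (simp add: d_def algebra_simps)
  then have "p ?z \<le> (1 - l) * p x + l * p u"
    using convex_onD[OF p(1), of l x u] l by simp
  moreover have "l * (p u - v \<bullet> d) \<le> l * p x"
    using convex_on_above_gradient[OF p, of x] l
    by (intro mult_left_mono) (auto simp: d_def inner_diff_right)
  ultimately have p': "p ?z \<le> p x + l * (v \<bullet> d)"
    by (simp add: algebra_simps)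
  have q': "q x + l * (\<xi> \<bullet> d) \<le> q ?z"
    using q[of ?z] by simp
  have "((Df x - \<xi>) + (1 / a) *\<^sub>R d + v) \<bullet> d = 0"
    using stat by (simp add: d_def)
  then have "Df x \<bullet> d + v \<bullet> d - \<xi> \<bullet> d = - (1 / a) * (norm d)\<^sup>2"
    by (simp add: inner_add_left inner_diff_left power2_norm_eq_inner)
  then have "l * (Df x \<bullet> d) + l * (v \<bullet> d) - l * (\<xi> \<bullet> d) = - l * (1 / a) * (norm d)\<^sup>2"
    by (metis (no_types, lifting) distrib_left minus_mult_commute mult.assoc right_diff_distrib)
  with f' p' q' have "f ?z + p ?z - q ?z
      \<le> f x + p x - q x + L * l\<^sup>2 * (norm d)\<^sup>2 - l * (1 / a) * (norm d)\<^sup>2"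
    by simp
  also have "\<dots> = f x + p x - q x - l * (1 / a - L * l) * (norm d)\<^sup>2"
    by (simp add: algebra_simps power2_eq_square)
  finally show ?thesis
    by (simp add: d_def)
qed

text \<open>
  Either the initial step 1 is accepted, or the last rejected step \<open>\<rho> ^ (k - 1)\<close> exceeds \<open>t\<close>.
\<close>

lemma backtracking_lower_bound:
  fixes \<rho> t :: real
  assumes \<rho>: "0 < \<rho>" "\<rho> \<le> 1"
    and small: "\<And>l. 0 < l \<Longrightarrow> l \<le> 1 \<Longrightarrow> l \<le> t \<Longrightarrow> P l"
    and rejected: "\<And>j. j < k \<Longrightarrow> \<not> P (\<rho> ^ j)"
  shows "min 1 (\<rho> * t) \<le> \<rho> ^ k"
proof (cases k)
  case (Suc j)
  have "t < \<rho> ^ j"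
    using small[of "\<rho> ^ j"] rejected[of j] \<rho> Suc by (force simp: power_le_one)
  then have "\<rho> * t \<le> \<rho> ^ k"
    using \<rho> Suc by simp
  then show ?thesis
    by simp
qed simp

section \<open>Finite length from the Kurdyka-Lojasiewicz inequality\<close>

lemma desingularizing_tangent:
  assumes "desingularizing \<nu> \<psi> \<psi>'" "0 < s" "ereal s < \<nu>" "0 \<le> t" "ereal t < \<nu>"
  shows "\<psi> t \<le> \<psi> s + \<psi>' s * (t - s)"
proof -
  define I where "I = {t::real. 0 \<le> t \<and> ereal t < \<nu>}"
  define J where "J = {t::real. 0 < t \<and> ereal t < \<nu>}"
  have "concave_on I \<psi>" and der: "(\<psi> has_real_derivative \<psi>' s) (at s)"
    using assms(1-3) by (auto simp: desingularizing_def Let_def I_def)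
  have "convex_on I (\<lambda>t. - \<psi> t)"
    using \<open>concave_on I \<psi>\<close> by (simp add: concave_on_def)
  moreover from this have "connected I"
    by (metis convex_on_imp_convex convex_connected)
  moreover have "s \<in> interior I"
  proof (rule interiorI)
    show "open J"
      unfolding J_def by (intro open_Collect_conj open_Collect_less continuous_intros) 
    show "s \<in> J" "J \<subseteq> I"
      using assms by (auto simp: I_def J_def)
  qed
  moreover have "t \<in> I"
    using assms by (simp add: I_def)
  moreover have "((\<lambda>t. - \<psi> t) has_field_derivative - \<psi>' s) (at s within I)"
    using DERIV_minus[OF der] by (rule has_field_derivative_at_within)
  ultimately have "- \<psi> t - - \<psi> s \<ge> - \<psi>' s * (t - s)"
    by (rule convex_on_imp_above_tangent)
  then show ?thesis
    by simp
qed

text \<open>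
  Here \<open>r n\<close> is the gap between the current value and its limit, and \<open>C * \<delta> n\<close> bounds the residual.
  While the sequence stays in \<open>U\<close>, concavity of \<open>\<psi>\<close> and the KL inequality give
  \<open>\<psi> (r n) - \<psi> (r (Suc n)) \<ge> \<psi>' (r n) * c * (\<delta> n)\<^sup>2 \<ge> c / C * \<delta> n\<close>, so the length travelled is at most
  \<open>C / c\<close> times the initial value of \<open>\<psi>\<close>. Started close to the cluster point \<open>l\<close> with
  a small gap, the sequence cannot travel far enough to leave \<open>U\<close>, and the estimate holds forever.
\<close>

lemma KL_finite_length:
  fixes x :: "nat \<Rightarrow> 'a::real_normed_vector" and r \<delta> :: "nat \<Rightarrow> real"
  assumes \<psi>: "desingularizing \<nu> \<psi> \<psi>'" and U: "open U" "l \<in> U"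
    and cluster: "\<And>e N. 0 < e \<Longrightarrow> \<exists>n\<ge>N. dist (x n) l < e"
    and r_pos: "\<And>n. 0 < r n" and r_lim: "r \<longlonglongrightarrow> 0" and "0 < \<nu>"
    and step: "\<And>n. norm (x (Suc n) - x n) \<le> \<delta> n"
    and decrease: "\<And>n. r (Suc n) + c * (\<delta> n)\<^sup>2 \<le> r n"
    and KL: "\<And>n. x n \<in> U \<Longrightarrow> ereal (r n) < \<nu> \<Longrightarrow> 1 \<le> \<psi>' (r n) * (C * \<delta> n)"
    and c: "0 < c" and C: "0 < C"
  shows "summable \<delta>"
proof -
  have \<delta>_nonneg: "0 \<le> \<delta> n" for n
    using step[of n] norm_ge_zero order_trans by blast
  have r_antimono: "r (Suc n) \<le> r n" for n
    using decrease[of n] c by (smt (verit) mult_nonneg_nonneg zero_le_power2)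
  have \<psi>_nonneg: "0 \<le> \<psi> (r n)" if "ereal (r n) < \<nu>" for n
    using \<psi> that r_pos[of n] by (auto simp: desingularizing_def Let_def)
  have one_step: "\<delta> n \<le> C / c * (\<psi> (r n) - \<psi> (r (Suc n)))"
    if "x n \<in> U" and less: "ereal (r n) < \<nu>" for n
  proof -
    have slope: "1 \<le> \<psi>' (r n) * (C * \<delta> n)"
      using KL that .
    have \<psi>'_pos: "0 < \<psi>' (r n)"
      using \<psi> less r_pos[of n] by (auto simp: desingularizing_def Let_def)
    have "ereal (r (Suc n)) < \<nu>"
      using r_antimono[of n] less by (meson ereal_less_eq(3) le_less_trans)
    then have "\<psi> (r (Suc n)) \<le> \<psi> (r n) + \<psi>' (r n) * (r (Suc n) - r n)"
      using desingularizing_tangent[OF \<psi>] r_pos less less_imp_le by blast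
    moreover have "\<psi>' (r n) * (c * (\<delta> n)\<^sup>2) \<le> \<psi>' (r n) * (r n - r (Suc n))"
      using decrease[of n] \<psi>'_pos by (intro mult_left_mono) auto
    ultimately have drop: "\<psi>' (r n) * (c * (\<delta> n)\<^sup>2) \<le> \<psi> (r n) - \<psi> (r (Suc n))"
      by (simp add: algebra_simps)
    have "1 * (c * \<delta> n) \<le> (\<psi>' (r n) * (C * \<delta> n)) * (c * \<delta> n)"
      using slope c \<delta>_nonneg by (intro mult_right_mono) auto
    also have "\<dots> = C * (\<psi>' (r n) * (c * (\<delta> n)\<^sup>2))"
      by (simp add: power2_eq_square)
    also have "\<dots> \<le> C * (\<psi> (r n) - \<psi> (r (Suc n)))"
      using drop C by (intro mult_left_mono) auto
    finally show ?thesis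
      using c by (simp add: field_simps)
  qed
  obtain e where e: "0 < e" "ball l e \<subseteq> U"
    using U open_contains_ball by blast
  have "(\<lambda>n. ereal (r n)) \<longlonglongrightarrow> ereal 0"
    using r_lim by simp
  then have below: "\<forall>\<^sub>F n in sequentially. ereal (r n) < \<nu>"
    using \<open>0 < \<nu>\<close> by (intro order_tendstoD) (auto simp: zero_ereal_def)
  have "(\<lambda>n. \<psi> (r n)) \<longlonglongrightarrow> \<psi> 0"
  proof (rule continuous_on_tendsto_compose[where f = \<psi> and g = r])
    show "continuous_on {t. 0 \<le> t \<and> ereal t < \<nu>} \<psi>"
      using \<psi> by (simp add: desingularizing_def Let_def)
    show "0 \<in> {t. 0 \<le> t \<and> ereal t < \<nu>}"
      using \<open>0 < \<nu>\<close> by (simp add: zero_ereal_def)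
    show "\<forall>\<^sub>F n in sequentially. r n \<in> {t. 0 \<le> t \<and> ereal t < \<nu>}"
      using below by eventually_elim (simp add: r_pos less_imp_le)
  qed (rule r_lim)
  then have "(\<lambda>n. C / c * \<psi> (r n)) \<longlonglongrightarrow> C / c * \<psi> 0"
    by (intro tendsto_intros)
  moreover have "\<psi> 0 = 0"
    using \<psi> by (simp add: desingularizing_def Let_def)
  ultimately have "\<forall>\<^sub>F n in sequentially. C / c * \<psi> (r n) < e / 2"
    using e by (intro order_tendstoD) auto
  moreover note below
  ultimately have "\<forall>\<^sub>F n in sequentially. C / c * \<psi> (r n) < e / 2 \<and> ereal (r n) < \<nu>"
    by (rule eventually_conj)
  then obtain N where N: "\<And>n. n \<ge> N \<Longrightarrow> C / c * \<psi> (r n) < e / 2 \<and> ereal (r n) < \<nu>"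
    by (auto simp: eventually_sequentially)
  obtain M where M: "M \<ge> N" "dist (x M) l < e / 2"
    using cluster[of "e / 2" N] e by auto
  have travelled: "dist (x (M + m)) (x M) \<le> (\<Sum>i<m. \<delta> (M + i))" for m
  proof (induction m)
    case (Suc m)
    have "dist (x (M + Suc m)) (x M)
        \<le> dist (x (Suc (M + m))) (x (M + m)) + dist (x (M + m)) (x M)"
      using dist_triangle by simp
    then show ?case
      using Suc step[of "M + m"] by (simp add: dist_norm)
  qed simp
  \<comment> \<open>The bound for the first \<open>m\<close> steps keeps \<open>x (M + m)\<close> in the ball, which allows one more step.\<close>
  have length: "(\<Sum>i<m. \<delta> (M + i)) \<le> C / c * (\<psi> (r M) - \<psi> (r (M + m)))" for m
  proof (induction m)
    case (Suc m)
    have "0 \<le> C / c * \<psi> (r (M + m))"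
      using N[of "M + m"] M \<psi>_nonneg c C by simp
    then have "dist (x (M + m)) (x M) < e / 2"
      using travelled[of m] Suc N[OF M(1)] unfolding right_diff_distrib by linarith
    then have "x (M + m) \<in> ball l e"
      using M(2) dist_triangle[of "x (M + m)" l "x M"] by (simp add: dist_commute)
    then have "\<delta> (M + m) \<le> C / c * (\<psi> (r (M + m)) - \<psi> (r (Suc (M + m))))"
      using one_step[of "M + m"] e N[of "M + m"] M by auto
    then show ?case
      using Suc by (simp add: right_diff_distrib)
  qed simp
  have "summable (\<lambda>i. \<delta> (M + i))"
  proof (rule summableI_nonneg_bounded)
    show "(\<Sum>i<m. \<delta> (M + i)) \<le> C / c * \<psi> (r M)" for m
    proof -
      have "0 \<le> C / c * \<psi> (r (M + m))"
        using N[of "M + m"] M \<psi>_nonneg c C by simp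
      then show ?thesis
        using length[of m] by (simp add: right_diff_distrib)
    qed
  qed (rule \<delta>_nonneg)
  then show ?thesis
    using summable_iff_shift[of \<delta> M] by (simp add: add.commute)
qed

lemma sufficient_decrease_tendsto_zero:
  fixes r \<delta> :: "nat \<Rightarrow> real"
  assumes "0 < c" and r: "r \<longlonglongrightarrow> z" and decrease: "\<And>n. r (Suc n) + c * (\<delta> n)\<^sup>2 \<le> r n"
  shows "\<delta> \<longlonglongrightarrow> 0"
proof -
  have "(\<lambda>n. r n - r (Suc n)) \<longlonglongrightarrow> 0"
    using tendsto_diff[OF r LIMSEQ_Suc[OF r]] by simp
  then have drop: "(\<lambda>n. (r n - r (Suc n)) / c) \<longlonglongrightarrow> 0"
    by (rule tendsto_divide_zero)
  have "norm ((\<delta> n)\<^sup>2) \<le> (r n - r (Suc n)) / c" for n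
    using decrease[of n] \<open>0 < c\<close> by (simp add: field_simps)
  then have "(\<lambda>n. (\<delta> n)\<^sup>2) \<longlonglongrightarrow> 0"
    by (intro Lim_null_comparison[OF _ drop] always_eventually allI)
  then show ?thesis
    by simp
qed

section \<open>Convergence of the proximal difference-of-convex method\<close>

theorem theorem1:
  fixes f :: "'a::euclidean_space \<Rightarrow> real"
    and g1 g2 :: "'a \<Rightarrow> ereal"
    and Df Dg1 :: "'a \<Rightarrow> 'a"
    and L L\<^sub>g\<^sub>1 :: real
    and x0 :: 'a
    and \<alpha>\<^sub>0 \<alpha>\<^sub>m\<^sub>i\<^sub>n \<alpha>\<^sub>m\<^sub>a\<^sub>x \<rho> \<omega> \<eta> :: real
    and x :: "nat \<Rightarrow> 'a"
  assumes f_convex: "convex_on UNIV f"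
    and f_grad: "\<And>z. GDERIV f z :> Df z"
    and f_lip: "lipschitz_on L UNIV Df"
    and g1_pcc: "proper_fun g1" "closed_fun g1" "convex_fun g1"
    and g2_pcc: "proper_fun g2" "closed_fun g2" "convex_fun g2"
    and E_bdd: "\<exists>m::real. \<forall>z. ereal m \<le> objective f g1 g2 z"
    and E_level: "\<And>a::real. compact {z. objective f g1 g2 z \<le> ereal a}"
    and g1_finite: "\<And>z. \<bar>g1 z\<bar> \<noteq> \<infinity>"
    and g1_grad: "\<And>z. GDERIV (\<lambda>y. real_of_ereal (g1 y)) z :> Dg1 z"
    and g1_lip: "lipschitz_on L\<^sub>g\<^sub>1 UNIV Dg1"
    and E_KL: "KL_property (objective f g1 g2) (objective_subdiff Df Dg1 g2)"
    and x_gen: "pBBDCA f Df g1 g2 x0 \<alpha>\<^sub>0 \<alpha>\<^sub>m\<^sub>i\<^sub>n \<alpha>\<^sub>m\<^sub>a\<^sub>x \<rho> \<omega> \<eta> x"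
  shows "(\<exists>N0::nat. antimono_on {N0<..} (\<lambda>n. objective f g1 g2 (x n))) \<and>
         (\<exists>\<zeta>::real. (\<lambda>n. objective f g1 g2 (x n)) \<longlonglongrightarrow> ereal \<zeta>) \<and>
         bounded (range x) \<and>
         (\<forall>l. cluster_point x l \<longrightarrow> critical_point (objective_subdiff Df Dg1 g2) l) \<and>
         convergent x \<and>
         summable (\<lambda>n. norm (x (Suc n) - x n))"
proof -
  define G1 where "G1 = (\<lambda>z. real_of_ereal (g1 z))"
  define G2 where "G2 = (\<lambda>z. real_of_ereal (g2 z))"
  define e where "e z = f z + G1 z - G2 z" for z
  obtain m where m: "\<And>z. ereal m \<le> objective f g1 g2 z"
    using E_bdd by blast
  have g2_finite: "\<bar>g2 z\<bar> \<noteq> \<infinity>" for z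
    using m[of z] g1_finite[of z] g2_pcc(1)
    by (cases "g1 z"; cases "g2 z") (auto simp: objective_def proper_fun_def)
  have objective: "objective f g1 g2 z = ereal (e z)" for z
    using g1_finite[of z] g2_finite[of z]
    by (cases "g1 z"; cases "g2 z") (auto simp: objective_def e_def G1_def G2_def)
  have G1_convex: "convex_on UNIV G1"
    unfolding G1_def using g1_pcc(3) g1_finite by (rule convex_on_real_of_ereal)
  have G2_convex: "convex_on UNIV G2"
    unfolding G2_def using g2_pcc(3) g2_finite by (rule convex_on_real_of_ereal)
  have G1_grad: "GDERIV G1 z :> Dg1 z" for z
    using g1_grad by (simp add: G1_def)
  have e_cont: "continuous_on UNIV e"
    unfolding e_def
    by (intro continuous_intros convex_on_continuous f_convex G1_convex G2_convex) auto
  have L: "0 \<le> L" and Lg: "0 \<le> L\<^sub>g\<^sub>1"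
    using f_lip g1_lip by (auto dest: lipschitz_on_nonneg)

  have params: "0 < \<alpha>\<^sub>m\<^sub>i\<^sub>n" "\<alpha>\<^sub>m\<^sub>i\<^sub>n < \<alpha>\<^sub>m\<^sub>a\<^sub>x" "0 < \<rho>" "\<rho> < 1" "0 < \<omega>" "0 < \<eta>" "\<eta> < 1 / \<alpha>\<^sub>m\<^sub>a\<^sub>x"
    using x_gen by (simp_all add: pBBDCA_def)
  from x_gen obtain \<xi> u d \<alpha> \<nu> k lam where iteration: "\<forall>n.
      \<xi> n \<in> subdifferential g2 (x n) \<and>
      is_arg_min (prox_model g1 (\<alpha> n) (Df (x n) - \<xi> n) (x n)) (\<lambda>_. True) (u n) \<and>
      d n = u n - x n \<and>
      \<nu> n = \<omega> / real (n + 1) * (norm (d n))\<^sup>2 \<and>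
      d n \<noteq> 0 \<and>
      line_search_accepts (objective f g1 g2) \<eta> (\<nu> n) (x n) (d n) (\<rho> ^ k n) \<and>
      (\<forall>j<k n. \<not> line_search_accepts (objective f g1 g2) \<eta> (\<nu> n) (x n) (d n) (\<rho> ^ j)) \<and>
      lam n = \<rho> ^ k n \<and>
      x (Suc n) = x n + lam n *\<^sub>R d n \<and>
      \<alpha> (Suc n) = BB_step \<alpha>\<^sub>m\<^sub>i\<^sub>n \<alpha>\<^sub>m\<^sub>a\<^sub>x (x (Suc n) - x n) (Df (x (Suc n)) - Df (x n))"
    unfolding pBBDCA_def by (elim conjE exE) (rule that)
  have \<xi>: "\<xi> n \<in> subdifferential g2 (x n)"
    and u: "is_arg_min (prox_model g1 (\<alpha> n) (Df (x n) - \<xi> n) (x n)) (\<lambda>_. True) (u n)"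
    and d: "d n = u n - x n"
    and \<nu>: "\<nu> n = \<omega> / real (n + 1) * (norm (d n))\<^sup>2"
    and d_nz: "d n \<noteq> 0"
    and accepted: "line_search_accepts (objective f g1 g2) \<eta> (\<nu> n) (x n) (d n) (\<rho> ^ k n)"
    and rejected: "j < k n \<Longrightarrow>
      \<not> line_search_accepts (objective f g1 g2) \<eta> (\<nu> n) (x n) (d n) (\<rho> ^ j)"
    and lam: "lam n = \<rho> ^ k n"
    and x_Suc: "x (Suc n) = x n + lam n *\<^sub>R d n"
    and \<alpha>_Suc: "\<alpha> (Suc n) = BB_step \<alpha>\<^sub>m\<^sub>i\<^sub>n \<alpha>\<^sub>m\<^sub>a\<^sub>x (x (Suc n) - x n) (Df (x (Suc n)) - Df (x n))" for n j
    using iteration[rule_format, of n] by blast+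
  \<comment> \<open>The initial \<open>\<alpha>\<^sub>0\<close> may lie outside these bounds.\<close>
  have \<alpha>_bounds: "\<alpha>\<^sub>m\<^sub>i\<^sub>n \<le> \<alpha> n" "\<alpha> n \<le> \<alpha>\<^sub>m\<^sub>a\<^sub>x" if "1 \<le> n" for n
  proof -
    from that obtain i where "n = Suc i"
      by (cases n) auto
    then show "\<alpha>\<^sub>m\<^sub>i\<^sub>n \<le> \<alpha> n" "\<alpha> n \<le> \<alpha>\<^sub>m\<^sub>a\<^sub>x"
      using params by (auto simp: \<alpha>_Suc BB_step_def)
  qed
  have lam_pos: "0 < lam n" and lam_le: "lam n \<le> 1" for n
    using params by (auto simp: lam power_le_one)
  have accepts: "line_search_accepts (objective f g1 g2) \<eta> (\<nu> n) (x n) (d n) l \<longleftrightarrow>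
      e (x n + l *\<^sub>R d n) \<le> e (x n) - \<eta> * l * (norm (d n))\<^sup>2 + \<nu> n" for n l
    by (simp add: line_search_accepts_def objective)
  have stationary: "(Df (x n) - \<xi> n) + (1 / \<alpha> n) *\<^sub>R (u n - x n) + Dg1 (u n) = 0" for n
    using g1_finite g1_grad u by (rule prox_model_stationary)

  \<comment> \<open>Up to the length \<open>t\<close> the second-order loss \<open>L * l\<close> fits into the margin \<open>1 / \<alpha>\<^sub>m\<^sub>a\<^sub>x - \<eta>\<close>; the
    denominator \<open>L + 1\<close> also covers \<open>L = 0\<close>.\<close>
  define t where "t = (1 / \<alpha>\<^sub>m\<^sub>a\<^sub>x - \<eta>) / (L + 1)"
  define \<tau> where "\<tau> = min 1 (\<rho> * t)"
  have "0 < t"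
    using params L by (simp add: t_def)
  then have \<tau>: "0 < \<tau>"
    using params by (simp add: \<tau>_def)
  have lam_ge: "\<tau> \<le> lam n" if n: "1 \<le> n" for n
    unfolding \<tau>_def lam
  proof (rule backtracking_lower_bound)
    show "\<not> line_search_accepts (objective f g1 g2) \<eta> (\<nu> n) (x n) (d n) (\<rho> ^ j)"
      if "j < k n" for j
      using rejected that .
    fix l :: real
    assume l: "0 < l" "l \<le> 1" "l \<le> t"
    have "e (x n + l *\<^sub>R d n) \<le> e (x n) - l * (1 / \<alpha> n - L * l) * (norm (d n))\<^sup>2"
      unfolding e_def d
    proof (rule dc_prox_descent[OF f_convex f_grad f_lip G1_convex G1_grad _ stationary])
      show "G2 (x n) + \<xi> n \<bullet> (y - x n) \<le> G2 y" for y
        using \<xi>[of n] by (simp add: subdifferential_real[OF g2_finite] G2_def)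
    qed (use l in auto)
    moreover have "l * \<eta> * (norm (d n))\<^sup>2 \<le> l * (1 / \<alpha> n - L * l) * (norm (d n))\<^sup>2"
    proof (intro mult_right_mono mult_left_mono)
      have "L * l \<le> (L + 1) * t"
        using l L by (intro mult_mono) auto
      also have "\<dots> = 1 / \<alpha>\<^sub>m\<^sub>a\<^sub>x - \<eta>"
        using L by (simp add: t_def)
      also have "1 / \<alpha>\<^sub>m\<^sub>a\<^sub>x \<le> 1 / \<alpha> n"
        using \<alpha>_bounds[OF n] params by (intro divide_left_mono) auto
      finally show "\<eta> \<le> 1 / \<alpha> n - L * l"
        by simp
    qed (use l in auto)
    moreover have "0 \<le> \<nu> n"
      using params by (simp add: \<nu>)
    ultimately show "line_search_accepts (objective f g1 g2) \<eta> (\<nu> n) (x n) (d n) l"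
      by (simp add: accepts mult.commute[of \<eta> l])
  qed (use params in auto)

  \<comment> \<open>The line search guarantees the decrease \<open>\<eta> * \<tau> * \<parallel>d\<^sup>n\<parallel>\<^sup>2\<close> up to the slack. One half of it is given to
    absorb the slack, which succeeds as soon as \<open>\<omega> / (n + 1) \<le> c\<close>; the successor in \<open>N\<close> ensures
    \<open>N \<ge> 1\<close>, where the bounds on \<open>\<alpha>\<^sub>n\<close> hold.\<close>
  define c where "c = \<eta> * \<tau> / 2"
  have c: "0 < c"
    using params \<tau> by (simp add: c_def)
  define N where "N = Suc (nat \<lceil>\<omega> / c\<rceil>)"
  have decrease: "e (x (Suc n)) + c * (norm (d n))\<^sup>2 \<le> e (x n)" if n: "N \<le> n" for n
  proof -
    have "\<omega> / c \<le> real (n + 1)"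
      using n unfolding N_def by linarith
    then have "\<omega> / real (n + 1) \<le> c"
      using c by (simp add: field_simps)
    moreover have "2 * c \<le> \<eta> * lam n"
      using lam_ge[of n] n params by (simp add: c_def N_def)
    ultimately have "c * (norm (d n))\<^sup>2 \<le> (\<eta> * lam n - \<omega> / real (n + 1)) * (norm (d n))\<^sup>2"
      by (intro mult_right_mono) auto
    then show ?thesis
      using accepted[of n] unfolding accepts
      by (simp add: x_Suc lam \<nu> left_diff_distrib)
  qed
  have decreasing: "e (x (Suc n)) < e (x n)" if "N \<le> n" for n
    using decrease[OF that] c d_nz[of n] by (smt (verit) mult_pos_pos zero_less_norm_iff zero_less_power)
  have antimono: "e (x j) \<le> e (x i)" if "N \<le> i" "i \<le> j" for i j
    using that(2)
  proof (induction j rule: dec_induct)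
    case (step j)
    then show ?case
      using decreasing[of j] that(1) by simp
  qed simp
  have "decseq (\<lambda>n. e (x (n + N)))"
    by (auto simp: decseq_def intro: antimono)
  moreover have "m \<le> e z" for z
    using m[of z] by (simp add: objective)
  ultimately obtain \<zeta> where \<zeta>: "(\<lambda>n. e (x (n + N))) \<longlonglongrightarrow> \<zeta>"
    and \<zeta>_le: "\<And>n. \<zeta> \<le> e (x (n + N))"
    using decseq_convergent[of "\<lambda>n. e (x (n + N))" m] by blast
  have e_lim: "(\<lambda>n. e (x n)) \<longlonglongrightarrow> \<zeta>"
    using \<zeta> by (rule LIMSEQ_offset)
  \<comment> \<open>The KL inequality speaks only about values strictly above \<open>\<zeta>\<close>; since \<open>d\<^sup>n \<noteq> 0\<close>, the limit is
    never attained.\<close>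
  have \<zeta>_less: "\<zeta> < e (x (n + N))" for n
    using \<zeta>_le[of "Suc n"] decreasing[of "n + N"] by simp
  have "bounded {z. objective f g1 g2 z \<le> ereal (e (x N))}"
    using E_level compact_imp_bounded by blast
  moreover have "bounded (x ` {..N})"
    by (simp add: finite_imp_bounded)
  ultimately have "bounded (x ` {..N} \<union> {z. objective f g1 g2 z \<le> ereal (e (x N))})"
    by simp
  moreover have "x n \<in> x ` {..N} \<union> {z. objective f g1 g2 z \<le> ereal (e (x N))}" for n
    using antimono[of N n] by (cases "n \<le> N") (auto simp: objective)
  ultimately have bdd: "bounded (range x)"
    by (blast intro: bounded_subset)

  have "(\<lambda>n. norm (d (n + N))) \<longlonglongrightarrow> 0"
    using c \<zeta> decrease by (intro sufficient_decrease_tendsto_zero[where c = c]) auto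
  then have "(\<lambda>n. norm (d n)) \<longlonglongrightarrow> 0"
    by (rule LIMSEQ_offset)
  then have d_lim: "d \<longlonglongrightarrow> 0"
    by (rule tendsto_norm_zero_cancel)
  have scaled: "norm ((1 / \<alpha> n) *\<^sub>R d n) \<le> 1 / \<alpha>\<^sub>m\<^sub>i\<^sub>n * norm (d n)" if "1 \<le> n" for n
    using \<alpha>_bounds[OF that] params by (auto simp: intro!: divide_left_mono mult_right_mono)
  have scaled_lim: "(\<lambda>n. (1 / \<alpha> n) *\<^sub>R d n) \<longlonglongrightarrow> 0"
  proof (rule Lim_null_comparison)
    show "\<forall>\<^sub>F n in sequentially. norm ((1 / \<alpha> n) *\<^sub>R d n) \<le> 1 / \<alpha>\<^sub>m\<^sub>i\<^sub>n * norm (d n)"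
      using scaled by (rule eventually_sequentiallyI)
    show "(\<lambda>n. 1 / \<alpha>\<^sub>m\<^sub>i\<^sub>n * norm (d n)) \<longlonglongrightarrow> 0"
      using d_lim by (intro tendsto_mult_right_zero tendsto_norm_zero)
  qed
  \<comment> \<open>By stationarity, \<open>\<xi>\<^sup>n\<close> differs from \<open>Df x\<^sup>n + Dg1 x\<^sup>n\<close> only by terms that are small with \<open>d\<^sup>n\<close>. This
    yields both criticality of cluster points and the residual bound.\<close>
  have \<xi>_eq: "\<xi> n = Df (x n) + (1 / \<alpha> n) *\<^sub>R d n + Dg1 (x n + d n)" for n
    using stationary[of n] by (simp add: d algebra_simps)

  have critical: "critical_point (objective_subdiff Df Dg1 g2) l" if cl: "cluster_point x l" for l
  proof -
    obtain r where r: "strict_mono r" and xr: "(x \<circ> r) \<longlonglongrightarrow> l"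
      using cl unfolding cluster_point_def by blast
    have dr: "(d \<circ> r) \<longlonglongrightarrow> 0"
      using d_lim r by (rule LIMSEQ_subseq_LIMSEQ)
    have sr: "((\<lambda>n. (1 / \<alpha> n) *\<^sub>R d n) \<circ> r) \<longlonglongrightarrow> 0"
      using scaled_lim r by (rule LIMSEQ_subseq_LIMSEQ)
    have Dfr: "(\<lambda>n. Df ((x \<circ> r) n)) \<longlonglongrightarrow> Df l"
      using lipschitz_on_continuous_on[OF f_lip] xr
      by (rule continuous_on_tendsto_compose) auto
    have Dgr: "(\<lambda>n. Dg1 ((x \<circ> r) n + (d \<circ> r) n)) \<longlonglongrightarrow> Dg1 (l + 0)"
      using lipschitz_on_continuous_on[OF g1_lip] tendsto_add[OF xr dr]
      by (rule continuous_on_tendsto_compose) auto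
    have \<xi>r: "(\<lambda>n. \<xi> (r n)) \<longlonglongrightarrow> Df l + 0 + Dg1 (l + 0)"
      using tendsto_add[OF tendsto_add[OF Dfr sr] Dgr] by (simp add: \<xi>_eq[symmetric])
    have "Df l + 0 + Dg1 (l + 0) \<in> subdifferential g2 l"
    proof (rule subdifferential_closed_graph[OF g2_pcc(3) g2_finite _ xr \<xi>r])
      show "\<xi> (r n) \<in> subdifferential g2 ((x \<circ> r) n)" for n
        using \<xi>[of "r n"] by simp
    qed
    then show ?thesis
      unfolding critical_point_def objective_subdiff_def
      by (intro CollectI exI[of _ "Df l + Dg1 l"]) simp
  qed

  define C where "C = L\<^sub>g\<^sub>1 + 1 / \<alpha>\<^sub>m\<^sub>i\<^sub>n"
  have C: "0 < C"
    using Lg params by (simp add: C_def add_nonneg_pos)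
  have residual: "dist_zero (objective_subdiff Df Dg1 g2 (x n)) \<le> ereal (C * norm (d n))"
    if n: "1 \<le> n" for n
  proof -
    let ?v = "Df (x n) + Dg1 (x n) - \<xi> n"
    have "?v = (Dg1 (x n) - Dg1 (x n + d n)) - (1 / \<alpha> n) *\<^sub>R d n"
      by (simp add: \<xi>_eq)
    then have "norm ?v \<le> norm (Dg1 (x n) - Dg1 (x n + d n)) + norm ((1 / \<alpha> n) *\<^sub>R d n)"
      using norm_triangle_ineq4 by metis
    moreover have "norm (Dg1 (x n) - Dg1 (x n + d n)) \<le> L\<^sub>g\<^sub>1 * norm (d n)"
      using lipschitz_onD[OF g1_lip, of "x n" "x n + d n"] by (simp add: dist_norm)
    ultimately have "norm ?v \<le> C * norm (d n)"
      using scaled[OF n] by (simp add: C_def distrib_right)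
    moreover have "?v \<in> objective_subdiff Df Dg1 g2 (x n)"
      using \<xi> by (auto simp: objective_subdiff_def)
    ultimately show ?thesis
      unfolding dist_zero_def by (intro INF_lower2) auto
  qed

  obtain l r where r: "strict_mono r" and xr: "(x \<circ> r) \<longlonglongrightarrow> l"
    using bounded_imp_convergent_subsequence[OF bdd] by blast
  then have "cluster_point x l"
    unfolding cluster_point_def by blast
  have "(\<lambda>n. e ((x \<circ> r) n)) \<longlonglongrightarrow> e l"
    using e_cont xr by (rule continuous_on_tendsto_compose) auto
  moreover have "(\<lambda>n. e ((x \<circ> r) n)) \<longlonglongrightarrow> \<zeta>"
    using LIMSEQ_subseq_LIMSEQ[OF e_lim r] by (simp add: comp_def)
  ultimately have el: "e l = \<zeta>"
    by (rule LIMSEQ_unique)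
  obtain \<nu>' U \<psi> \<psi>' where \<nu>': "0 < \<nu>'" and U: "open U" "l \<in> U" and \<psi>: "desingularizing \<nu>' \<psi> \<psi>'"
    and KL: "\<forall>z\<in>U. ereal (e l) < ereal (e z) \<and> ereal (e z) < ereal (e l) + \<nu>' \<longrightarrow>
      1 \<le> ereal (\<psi>' (real_of_ereal (ereal (e z) - ereal (e l))))
        * dist_zero (objective_subdiff Df Dg1 g2 z)"
    using E_KL critical[OF \<open>cluster_point x l\<close>] unfolding KL_property_def objective by meson
  have "summable (\<lambda>n. norm (d (n + N)))"
  proof (rule KL_finite_length[OF \<psi> U])
    show "\<exists>n\<ge>M. dist (x (n + N)) l < s" if s: "0 < s" for s M
    proof -
      have "\<forall>\<^sub>F n in sequentially. dist ((x \<circ> r) n) l < s"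
        using xr s by (rule tendstoD)
      then obtain K where K: "\<And>n. n \<ge> K \<Longrightarrow> dist (x (r n)) l < s"
        by (auto simp: eventually_sequentially)
      let ?i = "r (max K (M + N))"
      have "M + N \<le> ?i"
        using seq_suble[OF r, of "max K (M + N)"] by simp
      then show ?thesis
        using K[of "max K (M + N)"] by (intro exI[of _ "?i - N"]) auto
    qed
    show "0 < e (x (n + N)) - \<zeta>" for n
      using \<zeta>_less by simp
    show "(\<lambda>n. e (x (n + N)) - \<zeta>) \<longlonglongrightarrow> 0"
      using tendsto_diff[OF \<zeta> tendsto_const[of \<zeta>]] by simp
    show "norm (x (Suc n + N) - x (n + N)) \<le> norm (d (n + N))" for n
      using lam_pos[of "n + N"] lam_le[of "n + N"] by (simp add: x_Suc mult_left_le_one_le)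
    show "e (x (Suc n + N)) - \<zeta> + c * (norm (d (n + N)))\<^sup>2 \<le> e (x (n + N)) - \<zeta>" for n
      using decrease[of "n + N"] by simp
    show "1 \<le> \<psi>' (e (x (n + N)) - \<zeta>) * (C * norm (d (n + N)))"
      if "x (n + N) \<in> U" and less: "ereal (e (x (n + N)) - \<zeta>) < \<nu>'" for n
    proof -
      let ?s = "e (x (n + N)) - \<zeta>" and ?S = "objective_subdiff Df Dg1 g2 (x (n + N))"
      have "0 < \<psi>' ?s"
        using \<psi> less \<zeta>_less[of n] by (auto simp: desingularizing_def Let_def)
      then have "ereal (\<psi>' ?s) * dist_zero ?S \<le> ereal (\<psi>' ?s) * ereal (C * norm (d (n + N)))"
        by (intro ereal_mult_left_mono residual) (auto simp: N_def)
      moreover have "ereal (e (x (n + N))) < ereal \<zeta> + \<nu>'"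
        using less by (cases \<nu>') auto
      then have "1 \<le> ereal (\<psi>' ?s) * dist_zero ?S"
        using KL that(1) \<zeta>_less[of n] by (simp add: el)
      ultimately have "1 \<le> ereal (\<psi>' ?s) * ereal (C * norm (d (n + N)))"
        by (rule order_trans[rotated])
      then show ?thesis
        by simp
    qed
  qed (use \<nu>' c C in auto)
  then have "summable (\<lambda>n. norm (d n))"
    by (rule summable_iff_shift[THEN iffD1])
  then have length: "summable (\<lambda>n. norm (x (Suc n) - x n))"
  proof (rule summable_comparison_test')
    show "norm (norm (x (Suc n) - x n)) \<le> norm (d n)" if "n \<ge> 0" for n
      using lam_pos[of n] lam_le[of n] by (simp add: x_Suc mult_left_le_one_le)
  qed
  have "(\<lambda>n. x 0 + (\<Sum>i<n. x (Suc i) - x i)) \<longlonglongrightarrow> x 0 + (\<Sum>i. x (Suc i) - x i)"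
    using summable_LIMSEQ[OF summable_norm_cancel[OF length]] by (rule tendsto_add[OF tendsto_const])
  then have "convergent x"
    by (simp add: sum_lessThan_telescope convergentI)
  moreover have "antimono_on {N<..} (\<lambda>n. objective f g1 g2 (x n))"
    by (auto simp: monotone_on_def objective intro: antimono)
  moreover have "(\<lambda>n. objective f g1 g2 (x n)) \<longlonglongrightarrow> ereal \<zeta>"
    using e_lim by (simp add: objective)
  ultimately show ?thesis
    using bdd critical length by blast
qed

end
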